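(* Let $\{|\psi_1\rangle,|\psi_2\rangle,|\psi_3\rangle,|\psi_4\rangle\}$ be an orthonormal basis of the two-qubit space $\mathbb{C}^2\otimes\mathbb{C}^2$. If three of the basis vectors are product states, then the remaining basis vector is also a product state. Consequently, there is no orthonormal basis of $\mathbb{C}^2\otimes\mathbb{C}^2$ consisting of three product states and one entangled state.
   Context: A (pure) state is a unit vector. A unit vector in $\mathbb{C}^2\otimes\mathbb{C}^2$ is a product state if it equals $|u\rangle\otimes|v\rangle$ for some $|u\rangle,|v\rangle\in\mathbb{C}^2$, and it is entangled otherwise. *)

theory Defs
  imports "HOL-Analysis.Analysis"
begin

text \<open>
  The space \<open>\<complex>\<^sup>2 \<otimes> \<complex>\<^sup>2\<close> is modelled in coordinates: the entry of a vector at the index pair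
  \<open>(i, j)\<close> is its coefficient at \<open>e\<^sub>i \<otimes> e\<^sub>j\<close>.
\<close>

type_synonym qubit = "complex ^ 2"
type_synonym two_qubit = "complex ^ (2 \<times> 2)"

definition tensor :: "qubit \<Rightarrow> qubit \<Rightarrow> two_qubit"  (infixr "\<otimes>\<^sub>q" 75)
  where "u \<otimes>\<^sub>q v = (\<chi> p. u $ fst p * v $ snd p)"

text \<open>
  The Hermitian inner product, conjugate-linear in the first argument. The library's
  \<open>inner\<close> on \<open>complex ^ 'n\<close> is only its real part; the library's \<open>norm\<close> is the norm
  induced by both.
\<close>

definition hinner :: "complex ^ 'n \<Rightarrow> complex ^ 'n \<Rightarrow> complex"
  where "hinner x y = (\<Sum>i\<in>UNIV. cnj (x $ i) * y $ i)"

text \<open>Here \<open>vec.span\<close> is the span over the complex scalars, whereas \<open>span\<close> is the real one.\<close>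

definition orthonormal_basis :: "(complex ^ 'n) set \<Rightarrow> bool"
  where "orthonormal_basis B \<longleftrightarrow>
    (\<forall>x\<in>B. norm x = 1) \<and>
    (\<forall>x\<in>B. \<forall>y\<in>B. x \<noteq> y \<longrightarrow> hinner x y = 0) \<and>
    vec.span B = UNIV"

definition pure_state :: "complex ^ 'n \<Rightarrow> bool"
  where "pure_state \<psi> \<longleftrightarrow> norm \<psi> = 1"

definition product_state :: "two_qubit \<Rightarrow> bool"
  where "product_state \<psi> \<longleftrightarrow> pure_state \<psi> \<and> (\<exists>u v. \<psi> = u \<otimes>\<^sub>q v)"

definition entangled_state :: "two_qubit \<Rightarrow> bool"
  where "entangled_state \<psi> \<longleftrightarrow> pure_state \<psi> \<and> \<not> product_state \<psi>"

end

theory Submission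
  imports Defs
begin

text \<open>
  Two product vectors \<open>a\<^sub>i \<otimes> b\<^sub>i\<close> are orthogonal iff they are orthogonal in one of the two factors.
  Of the three pairs among three product vectors, two therefore are orthogonal in the same factor, say
  \<open>a\<^sub>1 \<bottom> a\<^sub>2\<close> and \<open>a\<^sub>1 \<bottom> a\<^sub>3\<close>. In dimension two this makes \<open>a\<^sub>2\<close> and \<open>a\<^sub>3\<close> parallel, so \<open>b\<^sub>2 \<bottom> b\<^sub>3\<close>, and
  the second and third vectors span \<open>a\<^sub>2 \<otimes> \<complex>\<^sup>2\<close>. A vector orthogonal to that space lies in \<open>a\<^sub>1 \<otimes> \<complex>\<^sup>2\<close>,
  hence is a product.
\<close>

lemma hinner_eq_zero_sym: "hinner x y = 0 \<longleftrightarrow> hinner y x = 0"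
proof -
  have "hinner y x = cnj (hinner x y)"
    by (simp add: hinner_def mult.commute)
  then show ?thesis by simp
qed

lemma hinner_self_eq_zero: "hinner x x = 0 \<longleftrightarrow> x = 0"
proof -
  have "hinner x x = of_real (\<Sum>i\<in>UNIV. (cmod (x $ i))\<^sup>2)"
    by (simp add: hinner_def complex_norm_square mult.commute flip: of_real_power)
  also have "\<dots> = 0 \<longleftrightarrow> x = 0"
    by (simp only: of_real_eq_0_iff) (simp add: sum_nonneg_eq_0_iff vec_eq_iff)
  finally show ?thesis .
qed

lemma hinner_scale_right: "hinner x (c *s y) = c * hinner x y"
  by (simp add: hinner_def sum_distrib_left mult_ac)

lemma hinner_scale_left: "hinner (c *s x) y = cnj c * hinner x y"
  by (simp add: hinner_def sum_distrib_left mult_ac)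

text \<open>The orthogonal complement of a nonzero \<open>x\<close> is a line in dimension two, and
  \<open>y\<close> and \<open>z\<close> both lie on it.\<close>

lemma qubit_orthogonal_parallel:
  fixes x y z :: qubit
  assumes "x \<noteq> 0" "y \<noteq> 0" "hinner x y = 0" "hinner x z = 0"
  shows "\<exists>c. z = c *s y"
proof -
  have xy: "cnj (x$1) * y$1 + cnj (x$2) * y$2 = 0" and xz: "cnj (x$1) * z$1 + cnj (x$2) * z$2 = 0"
    using assms by (simp_all add: hinner_def sum_2)
  \<comment> \<open>Cramer elimination: each coordinate of \<open>x\<close>, conjugated and
    multiplied by the determinant of \<open>y\<close> and \<open>z\<close>, is a combination of the
    two vanishing inner products.\<close>
  have "cnj (x$1) * (y$1 * z$2 - y$2 * z$1) =
      z$2 * (cnj (x$1) * y$1 + cnj (x$2) * y$2) - y$2 * (cnj (x$1) * z$1 + cnj (x$2) * z$2)"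
    "cnj (x$2) * (y$1 * z$2 - y$2 * z$1) =
      y$1 * (cnj (x$1) * z$1 + cnj (x$2) * z$2) - z$1 * (cnj (x$1) * y$1 + cnj (x$2) * y$2)"
    by (simp_all add: algebra_simps)
  then have "cnj (x$1) * (y$1 * z$2 - y$2 * z$1) = 0" "cnj (x$2) * (y$1 * z$2 - y$2 * z$1) = 0"
    unfolding xy xz by simp_all
  moreover have "x$1 \<noteq> 0 \<or> x$2 \<noteq> 0"
    using \<open>x \<noteq> 0\<close> by (auto simp: vec_eq_iff forall_2)
  ultimately have det: "y$1 * z$2 = y$2 * z$1" by auto
  show ?thesis
  \<comment> \<open>The factor is a quotient taken at a coordinate where \<open>y\<close> does not
    vanish; if \<open>y$1 = 0\<close>, then \<open>det\<close> forces \<open>z$1 = 0\<close> as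
    well.\<close>
  proof (cases "y$1 = 0")
    case True
    then have "y$2 \<noteq> 0"
      using \<open>y \<noteq> 0\<close> by (auto simp: vec_eq_iff forall_2)
    then have "z = (z$2 / y$2) *s y"
      using det True by (auto simp: vec_eq_iff forall_2)
    then show ?thesis ..
  next
    case False
    then have "z = (z$1 / y$1) *s y"
      using det by (auto simp: vec_eq_iff forall_2 field_simps)
    then show ?thesis ..
  qed
qed

lemma qubit_orthogonal_to_two:
  fixes x y w :: qubit
  assumes "x \<noteq> 0" "y \<noteq> 0" "hinner x y = 0" "hinner x w = 0" "hinner y w = 0"
  shows "w = 0"
proof -
  obtain c where c: "w = c *s y"
    using qubit_orthogonal_parallel assms by blast
  then have "c * hinner y y = 0"
    using assms by (simp add: hinner_scale_right)
  then show ?thesis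
    using assms c by (auto simp: hinner_self_eq_zero)
qed

lemma hinner_two_qubit:
  "hinner \<phi> \<psi> = (\<Sum>i\<in>UNIV. \<Sum>j\<in>UNIV. cnj (\<phi> $ (i, j)) * \<psi> $ (i, j))" for \<phi> \<psi> :: two_qubit
  unfolding hinner_def by (simp add: sum.cartesian_product flip: UNIV_Times_UNIV)

lemma hinner_tensor: "hinner (a \<otimes>\<^sub>q b) (c \<otimes>\<^sub>q d) = hinner a c * hinner b d"
  by (simp add: hinner_two_qubit tensor_def hinner_def sum_product mult_ac)

lemma tensor_scale_left: "(c *s a) \<otimes>\<^sub>q b = c *s (a \<otimes>\<^sub>q b)"
  by (simp add: tensor_def vec_eq_iff mult_ac)

lemma tensor_nonzeroD:
  assumes "a \<otimes>\<^sub>q b \<noteq> 0"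
  shows "a \<noteq> 0" "b \<noteq> 0"
  using assms by (auto simp: tensor_def vec_eq_iff)

text \<open>Contracting the first factor with \<open>a\<close> leaves a single-qubit vector, so
  orthogonality to a product vector becomes a statement about one qubit.\<close>

lemma hinner_tensor_left:
  "hinner (a \<otimes>\<^sub>q b) \<psi> = hinner b (\<chi> j. hinner a (\<chi> i. \<psi> $ (i, j)))"
  by (subst hinner_two_qubit, subst sum.swap)
    (simp add: tensor_def hinner_def sum_distrib_left mult_ac)

lemma tensor_if_orthogonal_left:
  assumes nz: "a\<^sub>1 \<otimes>\<^sub>q b\<^sub>1 \<noteq> 0" "a\<^sub>2 \<otimes>\<^sub>q b\<^sub>2 \<noteq> 0" "a\<^sub>3 \<otimes>\<^sub>q b\<^sub>3 \<noteq> 0"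
    and a12: "hinner a\<^sub>1 a\<^sub>2 = 0" and a13: "hinner a\<^sub>1 a\<^sub>3 = 0"
    and p23: "hinner (a\<^sub>2 \<otimes>\<^sub>q b\<^sub>2) (a\<^sub>3 \<otimes>\<^sub>q b\<^sub>3) = 0"
    and psi: "hinner (a\<^sub>2 \<otimes>\<^sub>q b\<^sub>2) \<psi> = 0" "hinner (a\<^sub>3 \<otimes>\<^sub>q b\<^sub>3) \<psi> = 0"
  shows "\<exists>u v. \<psi> = u \<otimes>\<^sub>q v"
proof -
  note nz' = nz[THEN tensor_nonzeroD(1)] nz[THEN tensor_nonzeroD(2)]
  \<comment> \<open>Otherwise \<open>a\<^sub>2\<close> and \<open>a\<^sub>3\<close> would be
    orthogonal, and \<open>a\<^sub>3\<close>, orthogonal to both \<open>a\<^sub>1\<close> and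
    \<open>a\<^sub>2\<close>, would vanish.\<close>
  have b23: "hinner b\<^sub>2 b\<^sub>3 = 0"
    using p23 qubit_orthogonal_to_two[OF nz'(1,2) a12 a13] nz' by (auto simp: hinner_tensor)
  obtain c where c: "a\<^sub>3 = c *s a\<^sub>2"
    using qubit_orthogonal_parallel[OF nz'(1,2) a12 a13] by blast
  have "c \<noteq> 0"
    using nz' c by auto
  then have psi3: "hinner (a\<^sub>2 \<otimes>\<^sub>q b\<^sub>3) \<psi> = 0"
    using psi by (simp add: c tensor_scale_left hinner_scale_left)
  \<comment> \<open>The contraction of \<open>\<psi>\<close> with \<open>a\<^sub>2\<close> is
    orthogonal to \<open>b\<^sub>2\<close> and \<open>b\<^sub>3\<close>, an orthogonal basis of the
    second factor.\<close>
  have "(\<chi> j. hinner a\<^sub>2 (\<chi> i. \<psi> $ (i, j))) = 0"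
    by (rule qubit_orthogonal_to_two[OF nz'(5,6) b23])
      (use psi(1) psi3 in \<open>simp_all only: hinner_tensor_left\<close>)
  then have "hinner a\<^sub>2 (\<chi> i. \<psi> $ (i, j)) = 0" for j
    by (simp add: vec_eq_iff)
  \<comment> \<open>Every slice of \<open>\<psi>\<close> along the first factor lies on the line
    orthogonal to \<open>a\<^sub>2\<close>, which \<open>a\<^sub>1\<close> spans; the coefficients
    form the second tensor factor.\<close>
  then have "\<exists>d. (\<chi> i. \<psi> $ (i, j)) = d *s a\<^sub>1" for j
    using qubit_orthogonal_parallel[of a\<^sub>2 a\<^sub>1] nz' a12 hinner_eq_zero_sym by blast
  then obtain d where "\<And>j. (\<chi> i. \<psi> $ (i, j)) = d j *s a\<^sub>1"
    by metis
  then have "\<psi> = a\<^sub>1 \<otimes>\<^sub>q (\<chi> j. d j)"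
    by (simp add: tensor_def vec_eq_iff mult.commute)
  then show ?thesis by blast
qed

text \<open>The unitary flip of the two qubits, which transfers results about the first factor to
  the second.\<close>

definition swap_factors :: "two_qubit \<Rightarrow> two_qubit"
  where "swap_factors \<psi> = (\<chi> p. \<psi> $ (snd p, fst p))"

lemma swap_factors_tensor: "swap_factors (a \<otimes>\<^sub>q b) = b \<otimes>\<^sub>q a"
  by (simp add: swap_factors_def tensor_def vec_eq_iff mult.commute)

lemma swap_factors_swap_factors: "swap_factors (swap_factors \<psi>) = \<psi>"
  by (simp add: swap_factors_def vec_eq_iff)

lemma swap_factors_eq_zero: "swap_factors \<psi> = 0 \<longleftrightarrow> \<psi> = 0"
  by (auto simp: swap_factors_def vec_eq_iff)

lemma hinner_swap_factors: "hinner (swap_factors \<phi>) (swap_factors \<psi>) = hinner \<phi> \<psi>"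
  unfolding hinner_two_qubit by (subst sum.swap) (simp add: swap_factors_def)

lemma tensor_if_orthogonal_right:
  assumes "a\<^sub>1 \<otimes>\<^sub>q b\<^sub>1 \<noteq> 0" "a\<^sub>2 \<otimes>\<^sub>q b\<^sub>2 \<noteq> 0" "a\<^sub>3 \<otimes>\<^sub>q b\<^sub>3 \<noteq> 0"
    and "hinner b\<^sub>1 b\<^sub>2 = 0" "hinner b\<^sub>1 b\<^sub>3 = 0"
    and "hinner (a\<^sub>2 \<otimes>\<^sub>q b\<^sub>2) (a\<^sub>3 \<otimes>\<^sub>q b\<^sub>3) = 0"
    and "hinner (a\<^sub>2 \<otimes>\<^sub>q b\<^sub>2) \<psi> = 0" "hinner (a\<^sub>3 \<otimes>\<^sub>q b\<^sub>3) \<psi> = 0"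
  shows "\<exists>u v. \<psi> = u \<otimes>\<^sub>q v"
proof -
  have nz: "b \<otimes>\<^sub>q a \<noteq> 0" if "a \<otimes>\<^sub>q b \<noteq> 0" for a b
    using that by (metis swap_factors_tensor swap_factors_eq_zero)
  have orth: "hinner (b \<otimes>\<^sub>q a) (swap_factors \<phi>) = 0" if "hinner (a \<otimes>\<^sub>q b) \<phi> = 0" for a b \<phi>
    using that by (metis swap_factors_tensor hinner_swap_factors)
  have "\<exists>u v. swap_factors \<psi> = u \<otimes>\<^sub>q v"
    using tensor_if_orthogonal_left[OF assms(1-3)[THEN nz] assms(4,5)
        assms(6)[THEN orth, unfolded swap_factors_tensor] assms(7,8)[THEN orth]] .
  then show ?thesis
    by (metis swap_factors_tensor swap_factors_swap_factors)
qed

lemma product_state_if_orthogonal_to_three: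
  assumes prod: "product_state p" "product_state q" "product_state r"
    and orth: "hinner p q = 0" "hinner p r = 0" "hinner q r = 0"
    and psi: "hinner p \<psi> = 0" "hinner q \<psi> = 0" "hinner r \<psi> = 0"
    and "pure_state \<psi>"
  shows "product_state \<psi>"
proof -
  obtain a\<^sub>1 b\<^sub>1 a\<^sub>2 b\<^sub>2 a\<^sub>3 b\<^sub>3 where eqs: "p = a\<^sub>1 \<otimes>\<^sub>q b\<^sub>1" "q = a\<^sub>2 \<otimes>\<^sub>q b\<^sub>2" "r = a\<^sub>3 \<otimes>\<^sub>q b\<^sub>3"
    using prod unfolding product_state_def by blast
  have nz: "a\<^sub>1 \<otimes>\<^sub>q b\<^sub>1 \<noteq> 0" "a\<^sub>2 \<otimes>\<^sub>q b\<^sub>2 \<noteq> 0" "a\<^sub>3 \<otimes>\<^sub>q b\<^sub>3 \<noteq> 0"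
    using prod unfolding product_state_def pure_state_def eqs by auto
  note sym = hinner_eq_zero_sym[THEN iffD1]
  note orth' = orth[unfolded eqs] and psi' = psi[unfolded eqs]
  have "hinner a\<^sub>1 a\<^sub>2 = 0 \<or> hinner b\<^sub>1 b\<^sub>2 = 0" "hinner a\<^sub>1 a\<^sub>3 = 0 \<or> hinner b\<^sub>1 b\<^sub>3 = 0"
    "hinner a\<^sub>2 a\<^sub>3 = 0 \<or> hinner b\<^sub>2 b\<^sub>3 = 0"
    using orth' by (simp_all add: hinner_tensor)
  \<comment> \<open>Pigeonhole on three pairs and two factors. Any two pairs share one vector, so a
    case is a choice of that vector and of the factor; the shared vector takes the role of index 1
    in the lemmas applied below.\<close>
  then consider
      "hinner a\<^sub>1 a\<^sub>2 = 0" "hinner a\<^sub>1 a\<^sub>3 = 0" | "hinner b\<^sub>1 b\<^sub>2 = 0" "hinner b\<^sub>1 b\<^sub>3 = 0"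
    | "hinner a\<^sub>1 a\<^sub>2 = 0" "hinner a\<^sub>2 a\<^sub>3 = 0" | "hinner b\<^sub>1 b\<^sub>2 = 0" "hinner b\<^sub>2 b\<^sub>3 = 0"
    | "hinner a\<^sub>1 a\<^sub>3 = 0" "hinner a\<^sub>2 a\<^sub>3 = 0" | "hinner b\<^sub>1 b\<^sub>3 = 0" "hinner b\<^sub>2 b\<^sub>3 = 0"
    by blast
  then have "\<exists>u v. \<psi> = u \<otimes>\<^sub>q v"
  proof cases
    case 1
    then show ?thesis
      by (rule tensor_if_orthogonal_left[OF nz _ _ orth'(3) psi'(2,3)])
  next
    case 2
    then show ?thesis
      by (rule tensor_if_orthogonal_right[OF nz _ _ orth'(3) psi'(2,3)])
  next
    case 3
    then show ?thesis
      by (intro tensor_if_orthogonal_left[OF nz(2,1,3) _ _ orth'(2) psi'(1,3)] sym[of a\<^sub>1 a\<^sub>2])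
  next
    case 4
    then show ?thesis
      by (intro tensor_if_orthogonal_right[OF nz(2,1,3) _ _ orth'(2) psi'(1,3)] sym[of b\<^sub>1 b\<^sub>2])
  next
    case 5
    then show ?thesis
      by (intro tensor_if_orthogonal_left[OF nz(3,1,2) _ _ orth'(1) psi'(1,2)]
          sym[of a\<^sub>1 a\<^sub>3] sym[of a\<^sub>2 a\<^sub>3])
  next
    case 6
    then show ?thesis
      by (intro tensor_if_orthogonal_right[OF nz(3,1,2) _ _ orth'(1) psi'(1,2)]
          sym[of b\<^sub>1 b\<^sub>3] sym[of b\<^sub>2 b\<^sub>3])
  qed
  then show ?thesis
    using \<open>pure_state \<psi>\<close> by (simp add: product_state_def)
qed

text \<open>Stated for a set \<open>S\<close> so that it serves both claims: \<open>S\<close> is the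
  image of the other three indices in one, and the set of all product states of the basis in the
  other.\<close>

lemma orthonormal_basis_product_state:
  assumes B: "orthonormal_basis B" and S: "S \<subseteq> B" "card S = 3" "\<And>x. x \<in> S \<Longrightarrow> product_state x"
    and psi: "\<psi> \<in> B" "\<psi> \<notin> S"
  shows "product_state \<psi>"
proof -
  obtain p q r where pqr: "S = {p, q, r}" "p \<noteq> q" "p \<noteq> r" "q \<noteq> r"
    using \<open>card S = 3\<close> by (auto simp: card_3_iff)
  have "hinner x y = 0" if "x \<in> B" "y \<in> B" "x \<noteq> y" for x y
    using B that by (auto simp: orthonormal_basis_def)
  moreover have "pure_state \<psi>"
    using B psi by (simp add: orthonormal_basis_def pure_state_def)
  ultimately show ?thesis
    by - (rule product_state_if_orthogonal_to_three[of p q r], use S psi pqr in auto)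
qed

theorem theorem13:
  "(\<forall>\<psi> :: 4 \<Rightarrow> two_qubit.
      inj \<psi> \<and> orthonormal_basis (range \<psi>) \<longrightarrow>
      (\<forall>k. (\<forall>j. j \<noteq> k \<longrightarrow> product_state (\<psi> j)) \<longrightarrow> product_state (\<psi> k))) \<and>
   (\<nexists>B :: two_qubit set. orthonormal_basis B \<and>
      card {\<psi> \<in> B. product_state \<psi>} = 3 \<and>
      card {\<psi> \<in> B. entangled_state \<psi>} = 1)"
proof (intro conjI allI impI notI; (elim exE conjE)?)
  fix \<psi> :: "4 \<Rightarrow> two_qubit" and k
  assume "inj \<psi>" and B: "orthonormal_basis (range \<psi>)" and prod: "\<forall>j. j \<noteq> k \<longrightarrow> product_state (\<psi> j)"
  \<comment> \<open>Injectivity keeps the three other vectors distinct from each other and from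
    \<open>\<psi> k\<close>.\<close>
  have "card (\<psi> ` (UNIV - {k})) = 3"
    using \<open>inj \<psi>\<close> by (subst card_image) (auto intro: inj_on_subset)
  moreover have "\<psi> k \<notin> \<psi> ` (UNIV - {k})"
    using \<open>inj \<psi>\<close> by (auto dest: injD)
  ultimately show "product_state (\<psi> k)"
    by - (rule orthonormal_basis_product_state[OF B, of "\<psi> ` (UNIV - {k})"], use prod in auto)
next
  fix B :: "two_qubit set"
  assume B: "orthonormal_basis B" and prod: "card {\<psi> \<in> B. product_state \<psi>} = 3"
    and ent: "card {\<psi> \<in> B. entangled_state \<psi>} = 1"
  obtain \<psi> where "{\<psi> \<in> B. entangled_state \<psi>} = {\<psi>}"
    using ent by (rule card_1_singletonE)
  then have psi: "\<psi> \<in> B" "\<not> product_state \<psi>"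
    by (auto simp: entangled_state_def)
  have "product_state \<psi>"
    by (rule orthonormal_basis_product_state[OF B _ prod]) (use psi in auto)
  with psi show False by blast
qed

end
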